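(* Let $\alpha: I\subset\mathbb{R}\to\mathbb{E}^3$ be a unit speed regular curve having a Frenet frame with unit binormal vector $B$, let $\{\zeta_1,\zeta_2,B\}$ be a differentiable, positively oriented orthonormal frame along $\alpha$, and let $\varepsilon_1,\varepsilon_2: I\to\mathbb{R}$ be functions. Let $\lambda: I\to\mathbb{C}^2$ be a differentiable two-component spinor with $\overline{\lambda}^{\,t}\lambda=1$ which represents the triad $\{\zeta_1,\zeta_2,B\}$, i.e. $$\zeta_1+i\zeta_2=\lambda^t\sigma\lambda,\qquad B=-\hat\lambda^{\,t}\sigma\lambda .$$ Then the type-2 Bishop equations with Bishop curvatures $\varepsilon_1,\varepsilon_2$, $$\frac{d\zeta_1}{ds}=-\varepsilon_1B,\qquad \frac{d\zeta_2}{ds}=-\varepsilon_2B,\qquad \frac{dB}{ds}=\varepsilon_1\zeta_1+\varepsilon_2\zeta_2,$$ are equivalent to the single spinor equation $$\frac{d\lambda}{ds}=\frac12\,(\varepsilon_1+i\,\varepsilon_2)\,\hat\lambda .$$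
   Context: $\mathbb{E}^3$ is $\mathbb{R}^3$ with the standard flat metric. A spinor is a vector $\lambda=\begin{pmatrix}\lambda_1\\ \lambda_2\end{pmatrix}\in\mathbb{C}^2$; $\overline{\lambda}$ is its componentwise complex conjugate, the superscript $t$ denotes transposition, and the mate of $\lambda$ is $\hat\lambda=\begin{pmatrix}-\overline{\lambda_2}\\ \overline{\lambda_1}\end{pmatrix}$. The symbol $\sigma=(\sigma_1,\sigma_2,\sigma_3)$ denotes the triple of complex symmetric matrices $$\sigma_1=\begin{pmatrix}1&0\\0&-1\end{pmatrix},\quad \sigma_2=\begin{pmatrix}i&0\\0&i\end{pmatrix},\quad \sigma_3=\begin{pmatrix}0&-1\\-1&0\end{pmatrix},$$ and for spinors $\phi,\psi$ one writes $\phi^t\sigma\psi=(\phi^t\sigma_1\psi,\phi^t\sigma_2\psi,\phi^t\sigma_3\psi)\in\mathbb{C}^3$. A frame $\{\zeta_1,\zeta_2,B\}$ along a unit speed curve, with $B$ the Frenet binormal, satisfying the three displayed equations is called a type-2 Bishop frame, and the real functions $\varepsilon_1,\varepsilon_2$ are called its type-2 Bishop curvatures. *)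

theory Defs
  imports "HOL-Analysis.Analysis"
begin

text \<open>All derivatives are taken within the parameter interval, so that they are one-sided
  at an end point belonging to it and ordinary derivatives at interior points.\<close>

definition unit_speed_curve :: "real set \<Rightarrow> (real \<Rightarrow> real^3) \<Rightarrow> bool" where
  "unit_speed_curve I \<alpha> \<longleftrightarrow>
     (\<forall>s\<in>I. \<exists>v. (\<alpha> has_vector_derivative v) (at s within I) \<and> norm v = 1)"

definition frenet_frame ::
  "real set \<Rightarrow> (real \<Rightarrow> real^3) \<Rightarrow> (real \<Rightarrow> real^3) \<Rightarrow> (real \<Rightarrow> real^3) \<Rightarrow> (real \<Rightarrow> real^3) \<Rightarrow> bool"
  where
  "frenet_frame I \<alpha> T N B \<longleftrightarrow>
     (\<forall>s\<in>I. (\<alpha> has_vector_derivative T s) (at s within I) \<and>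
        (\<exists>w. (T has_vector_derivative w) (at s within I) \<and> w \<noteq> 0 \<and> N s = w /\<^sub>R norm w) \<and>
        B s = cross3 (T s) (N s))"

definition oriented_orthonormal_frame ::
  "real set \<Rightarrow> (real \<Rightarrow> real^3) \<Rightarrow> (real \<Rightarrow> real^3) \<Rightarrow> (real \<Rightarrow> real^3) \<Rightarrow> bool" where
  "oriented_orthonormal_frame I X Y Z \<longleftrightarrow>
     (\<forall>s\<in>I. norm (X s) = 1 \<and> norm (Y s) = 1 \<and> norm (Z s) = 1 \<and>
        X s \<bullet> Y s = 0 \<and> X s \<bullet> Z s = 0 \<and> Y s \<bullet> Z s = 0 \<and>
        det (vector [X s, Y s, Z s] :: real^3^3) > 0)"

text \<open>Spinors are elements of \<open>complex^2\<close>.\<close>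

definition mate :: "complex^2 \<Rightarrow> complex^2" where
  "mate \<phi> = vector [- cnj (\<phi>$2), cnj (\<phi>$1)]"

definition sigma1 :: "complex^2^2" where
  "sigma1 = vector [vector [1, 0], vector [0, -1]]"

definition sigma2 :: "complex^2^2" where
  "sigma2 = vector [vector [\<i>, 0], vector [0, \<i>]]"

definition sigma3 :: "complex^2^2" where
  "sigma3 = vector [vector [0, -1], vector [-1, 0]]"

text \<open>The product \<open>\<phi>\<^sup>t M \<psi>\<close> is bilinear: no conjugation of \<open>\<phi>\<close>, so the library's inner product
  on \<open>complex^2\<close> is not the one needed.\<close>

definition transpose_mult :: "complex^2 \<Rightarrow> complex^2^2 \<Rightarrow> complex^2 \<Rightarrow> complex" where
  "transpose_mult \<phi> M \<psi> = (\<Sum>i\<in>UNIV. \<phi>$i * (M *v \<psi>)$i)"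

definition sigma_form :: "complex^2 \<Rightarrow> complex^2 \<Rightarrow> complex^3" where
  "sigma_form \<phi> \<psi> =
     vector [transpose_mult \<phi> sigma1 \<psi>, transpose_mult \<phi> sigma2 \<psi>, transpose_mult \<phi> sigma3 \<psi>]"

definition complexify :: "real^3 \<Rightarrow> complex^3" where
  "complexify v = (\<chi> k. complex_of_real (v$k))"

definition represents_triad ::
  "(real \<Rightarrow> complex^2) \<Rightarrow> real set \<Rightarrow> (real \<Rightarrow> real^3) \<Rightarrow> (real \<Rightarrow> real^3) \<Rightarrow> (real \<Rightarrow> real^3) \<Rightarrow> bool"
  where
  "represents_triad \<phi> I X Y Z \<longleftrightarrow>
     (\<forall>s\<in>I. complexify (X s) + \<i> *s complexify (Y s) = sigma_form (\<phi> s) (\<phi> s) \<and>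
        complexify (Z s) = - sigma_form (mate (\<phi> s)) (\<phi> s))"

definition type2_bishop_equations ::
  "real set \<Rightarrow> (real \<Rightarrow> real^3) \<Rightarrow> (real \<Rightarrow> real^3) \<Rightarrow> (real \<Rightarrow> real^3) \<Rightarrow>
     (real \<Rightarrow> real) \<Rightarrow> (real \<Rightarrow> real) \<Rightarrow> bool" where
  "type2_bishop_equations I \<zeta>1 \<zeta>2 B \<epsilon>1 \<epsilon>2 \<longleftrightarrow>
     (\<forall>s\<in>I. (\<zeta>1 has_vector_derivative - (\<epsilon>1 s *\<^sub>R B s)) (at s within I) \<and>
        (\<zeta>2 has_vector_derivative - (\<epsilon>2 s *\<^sub>R B s)) (at s within I) \<and>
        (B has_vector_derivative \<epsilon>1 s *\<^sub>R \<zeta>1 s + \<epsilon>2 s *\<^sub>R \<zeta>2 s) (at s within I))"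

end

theory Submission
  imports Defs
begin

text \<open>Differentiating \<open>\<phi>\<^sup>t\<sigma>\<phi>\<close> gives \<open>2 \<phi>\<^sup>t\<sigma>\<phi>'\<close>. If \<open>\<phi>' = k \<phi>^\<close> with \<open>2 k = \<epsilon>1 + i \<epsilon>2\<close>, where
  \<open>\<phi>^\<close> is the mate, this is \<open>- 2 k B\<close>, whose real and imaginary parts are the first two Bishop
  equations; the third follows in the same way from \<open>(\<phi>^)^ = - \<phi>\<close>. Conversely, \<open>\<psi> \<mapsto> \<phi>\<^sup>t\<sigma>\<psi>\<close> is
  injective for \<open>\<phi> \<noteq> 0\<close>, so the first two Bishop equations already determine \<open>\<phi>'\<close>.\<close>

lemma transpose_mult_sigma [simp]:
  "transpose_mult \<phi> sigma1 \<psi> = \<phi>$1 * \<psi>$1 - \<phi>$2 * \<psi>$2"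
  "transpose_mult \<phi> sigma2 \<psi> = \<i> * (\<phi>$1 * \<psi>$1 + \<phi>$2 * \<psi>$2)"
  "transpose_mult \<phi> sigma3 \<psi> = - (\<phi>$1 * \<psi>$2 + \<phi>$2 * \<psi>$1)"
  by (simp_all add: transpose_mult_def sigma1_def sigma2_def sigma3_def
      matrix_vector_mult_def sum_2 algebra_simps)

lemma sigma_form_nth [simp]:
  "sigma_form \<phi> \<psi> $ 1 = \<phi>$1 * \<psi>$1 - \<phi>$2 * \<psi>$2"
  "sigma_form \<phi> \<psi> $ 2 = \<i> * (\<phi>$1 * \<psi>$1 + \<phi>$2 * \<psi>$2)"
  "sigma_form \<phi> \<psi> $ 3 = - (\<phi>$1 * \<psi>$2 + \<phi>$2 * \<psi>$1)"
  by (simp_all add: sigma_form_def)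

lemma mate_nth [simp]: "mate \<phi> $ 1 = - cnj (\<phi>$2)" "mate \<phi> $ 2 = cnj (\<phi>$1)"
  by (simp_all add: mate_def)

lemma mate_mate: "mate (mate \<phi>) = - \<phi>"
  by (simp add: vec_eq_iff forall_2)

lemma mate_smult: "mate (c *s \<phi>) = cnj c *s mate \<phi>"
  by (simp add: vec_eq_iff forall_2)

lemma sigma_form_commute: "sigma_form \<phi> \<psi> = sigma_form \<psi> \<phi>"
  by (simp add: vec_eq_iff forall_3)

lemma sigma_form_smult_right: "sigma_form \<phi> (c *s \<psi>) = c *s sigma_form \<phi> \<psi>"
  by (simp add: vec_eq_iff forall_3 algebra_simps)

lemma sigma_form_smult_left: "sigma_form (c *s \<phi>) \<psi> = c *s sigma_form \<phi> \<psi>"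
  by (simp add: vec_eq_iff forall_3 algebra_simps)

text \<open>Each entry of \<sigma> changes sign under mate and conjugation together. For a triad
  with \<open>sigma_form \<phi> \<phi>\<close> = X + iY, the right-hand side is -(X - iY), which
  brings X and Y back when B is differentiated.\<close>

lemma sigma_form_mate_mate:
  "sigma_form (mate \<phi>) (mate \<phi>) = - (\<chi> k. cnj (sigma_form \<phi> \<phi> $ k))"
  by (simp add: vec_eq_iff forall_3 algebra_simps)

lemma bounded_bilinear_sigma_form: "bounded_bilinear sigma_form"
  unfolding bilinear_conv_bounded_bilinear[symmetric] bilinear_def
  by (auto intro!: linearI simp: vec_eq_iff forall_3 algebra_simps scaleR_conv_of_real[where 'a = complex])

text \<open>For the difference \<open>d\<close>, the first two components make both the difference
  and the sum of \<open>\<phi>$1 * d$1\<close> and \<open>\<phi>$2 * d$2\<close> vanish, hence both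
  products. A nonzero entry of \<open>\<phi>\<close> then kills one entry of \<open>d\<close>, and
  the third component kills the other.\<close>

lemma sigma_form_right_cancel:
  assumes "\<phi> \<noteq> 0" "sigma_form \<phi> \<psi> = sigma_form \<phi> \<omega>"
  shows "\<psi> = \<omega>"
proof -
  define d where "d = \<psi> - \<omega>"
  have "sigma_form \<phi> d = 0"
    using assms(2)
    by (simp add: d_def bounded_bilinear.diff_right[OF bounded_bilinear_sigma_form])
  then have diff: "\<phi>$1 * d$1 = \<phi>$2 * d$2" and sum: "\<phi>$1 * d$1 + \<phi>$2 * d$2 = 0"
    and cross: "\<phi>$1 * d$2 + \<phi>$2 * d$1 = 0"
    using complex_i_not_zero
    unfolding vec_eq_iff forall_3 sigma_form_nth zero_index mult_eq_0_iff
      neg_equal_0_iff_equal right_minus_eq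
    by blast+
  have "\<phi>$1 * d$1 = 0" "\<phi>$2 * d$2 = 0"
    using diff sum by simp_all
  moreover have "\<phi>$1 \<noteq> 0 \<or> \<phi>$2 \<noteq> 0"
    using assms(1) by (simp add: vec_eq_iff forall_2)
  ultimately have "d = 0"
    using cross by (auto simp: vec_eq_iff forall_2)
  then show ?thesis by (simp add: d_def)
qed

text \<open>Mate is conjugate-linear over the complex numbers, but real linearity is enough to
  differentiate in a real parameter.\<close>

lemma bounded_linear_mate: "bounded_linear mate"
  unfolding linear_conv_bounded_linear[symmetric]
  by (auto intro!: linearI simp: vec_eq_iff forall_2 algebra_simps)

text \<open>These real-linear projections recover X and Y from X + iY and commute with
  differentiation.\<close>

definition Re_vec :: "complex^'n \<Rightarrow> real^'n" where
  "Re_vec v = (\<chi> k. Re (v$k))"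

definition Im_vec :: "complex^'n \<Rightarrow> real^'n" where
  "Im_vec v = (\<chi> k. Im (v$k))"

lemma bounded_linear_Re_vec: "bounded_linear Re_vec"
  unfolding linear_conv_bounded_linear[symmetric]
  by (auto intro!: linearI simp: vec_eq_iff Re_vec_def)

lemma bounded_linear_Im_vec: "bounded_linear Im_vec"
  unfolding linear_conv_bounded_linear[symmetric]
  by (auto intro!: linearI simp: vec_eq_iff Im_vec_def)

lemma bounded_linear_complexify: "bounded_linear complexify"
  unfolding linear_conv_bounded_linear[symmetric]
  by (auto intro!: linearI simp: vec_eq_iff complexify_def scaleR_conv_of_real[where 'a = complex])

lemma bounded_linear_smult: "bounded_linear (\<lambda>v::complex^'n. c *s v)"
  unfolding linear_conv_bounded_linear[symmetric]
  by (auto intro!: linearI simp: vec_eq_iff algebra_simps)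

text \<open>A connected set with more than one point has no isolated point; nonempty interior
  excludes the singleton. This is what makes derivatives within \<open>I\<close> unique.\<close>

lemma at_within_interval_neq_bot:
  fixes I :: "real set"
  assumes "is_interval I" "interior I \<noteq> {}" "s \<in> I"
  shows "at s within I \<noteq> bot"
proof -
  have "I \<noteq> {s}"
    using assms(2) by auto
  then have "s islimpt I"
    using assms(1,3) by (intro connected_imp_perfect) (auto simp: is_interval_connected_1)
  then show ?thesis
    using trivial_limit_within by blast
qed

lemma has_vector_derivative_sigma_form:
  assumes "(f has_vector_derivative f') (at s within I)"
    and "(g has_vector_derivative g') (at s within I)"
  shows "((\<lambda>t. sigma_form (f t) (g t)) has_vector_derivative
      sigma_form (f s) g' + sigma_form f' (g s)) (at s within I)"
  by (rule bounded_bilinear.has_vector_derivative[OF bounded_bilinear_sigma_form assms])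

lemma spinor_equation_imp_bishop:
  assumes rep: "represents_triad \<phi> I X Y Z" and s: "s \<in> I"
    and der: "(\<phi> has_vector_derivative
        ((1/2) * (complex_of_real a + \<i> * complex_of_real b)) *s mate (\<phi> s)) (at s within I)"
  shows "(X has_vector_derivative - (a *\<^sub>R Z s)) (at s within I)"
    and "(Y has_vector_derivative - (b *\<^sub>R Z s)) (at s within I)"
    and "(Z has_vector_derivative a *\<^sub>R X s + b *\<^sub>R Y s) (at s within I)"
proof -
  define k where "k = (1/2) * (complex_of_real a + \<i> * complex_of_real b)"
  have XY: "complexify (X t) + \<i> *s complexify (Y t) = sigma_form (\<phi> t) (\<phi> t)"
    and Z: "complexify (Z t) = - sigma_form (mate (\<phi> t)) (\<phi> t)" if "t \<in> I" for t
    using rep that by (auto simp: represents_triad_def)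
  have X': "Re_vec (sigma_form (\<phi> t) (\<phi> t)) = X t"
    and Y': "Im_vec (sigma_form (\<phi> t) (\<phi> t)) = Y t"
    and Z': "Re_vec (- sigma_form (mate (\<phi> t)) (\<phi> t)) = Z t" if "t \<in> I" for t
    unfolding XY[OF that, symmetric] Z[OF that, symmetric]
    by (simp_all add: vec_eq_iff Re_vec_def Im_vec_def complexify_def)
  have der: "(\<phi> has_vector_derivative k *s mate (\<phi> s)) (at s within I)"
    using der by (simp add: k_def)
  \<comment> \<open>The two terms of the product rule agree by symmetry of the form; the resulting 2
    absorbs the 1/2 in \<open>k\<close>, so that 2k = a + ib.\<close>
  have "sigma_form (\<phi> s) (k *s mate (\<phi> s)) + sigma_form (k *s mate (\<phi> s)) (\<phi> s)
      = (2 * k) *s sigma_form (mate (\<phi> s)) (\<phi> s)"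
    by (simp add: sigma_form_smult_left sigma_form_smult_right sigma_form_commute[of "\<phi> s"]
        vec_eq_iff)
  also have "\<dots> = - ((2 * k) *s complexify (Z s))"
    by (simp add: Z[OF s] vec_eq_iff)
  finally have der_form: "((\<lambda>t. sigma_form (\<phi> t) (\<phi> t)) has_vector_derivative
      - ((2 * k) *s complexify (Z s))) (at s within I)"
    using has_vector_derivative_sigma_form[OF der der] by simp
  have "Re_vec (- ((2 * k) *s complexify (Z s))) = - (a *\<^sub>R Z s)"
    by (simp add: vec_eq_iff Re_vec_def complexify_def k_def)
  then show "(X has_vector_derivative - (a *\<^sub>R Z s)) (at s within I)"
    using bounded_linear.has_vector_derivative[OF bounded_linear_Re_vec der_form]
    by (auto intro: has_vector_derivative_transform[OF s, rotated] simp: X')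
  have "Im_vec (- ((2 * k) *s complexify (Z s))) = - (b *\<^sub>R Z s)"
    by (simp add: vec_eq_iff Im_vec_def complexify_def k_def)
  then show "(Y has_vector_derivative - (b *\<^sub>R Z s)) (at s within I)"
    using bounded_linear.has_vector_derivative[OF bounded_linear_Im_vec der_form]
    by (auto intro: has_vector_derivative_transform[OF s, rotated] simp: Y')
  \<comment> \<open>Conjugate-linearity replaces \<open>k\<close> by \<open>cnj k\<close>, and the
    double mate supplies the sign.\<close>
  have "mate (k *s mate (\<phi> s)) = (- cnj k) *s \<phi> s"
    by (simp add: mate_smult mate_mate vec_eq_iff)
  then have der_mate: "((\<lambda>t. mate (\<phi> t)) has_vector_derivative (- cnj k) *s \<phi> s) (at s within I)"
    using bounded_linear.has_vector_derivative[OF bounded_linear_mate der] by simp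
  \<comment> \<open>The argument of \<open>Re_vec\<close> is k(X - iY) + cnj k (X + iY), twice the
    real part of cnj k (X + iY). With 2k = a + ib this is aX + bY.\<close>
  have "Re_vec (- (sigma_form (mate (\<phi> s)) (k *s mate (\<phi> s))
        + sigma_form ((- cnj k) *s \<phi> s) (\<phi> s))) = a *\<^sub>R X s + b *\<^sub>R Y s"
    unfolding sigma_form_smult_left sigma_form_smult_right sigma_form_mate_mate
    unfolding XY[OF s, symmetric]
    by (simp add: vec_eq_iff Re_vec_def complexify_def k_def field_simps)
  then show "(Z has_vector_derivative a *\<^sub>R X s + b *\<^sub>R Y s) (at s within I)"
    using bounded_linear.has_vector_derivative[OF bounded_linear_Re_vec
        has_vector_derivative_minus[OF has_vector_derivative_sigma_form[OF der_mate der]]]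
    by (auto intro: has_vector_derivative_transform[OF s, rotated] simp: Z')
qed

text \<open>Differentiability of \<open>\<phi>\<close> provides some derivative \<open>D\<close>; it
  is identified by differentiating X + iY in two ways. \<open>nontriv\<close> lets the two results
  be equated and \<open>nz\<close> lets the form be cancelled.\<close>

lemma bishop_imp_spinor_equation:
  assumes rep: "represents_triad \<phi> I X Y Z" and s: "s \<in> I"
    and nontriv: "at s within I \<noteq> bot" and nz: "\<phi> s \<noteq> 0"
    and diff: "\<phi> differentiable (at s within I)"
    and dX: "(X has_vector_derivative - (a *\<^sub>R Z s)) (at s within I)"
    and dY: "(Y has_vector_derivative - (b *\<^sub>R Z s)) (at s within I)"
  shows "(\<phi> has_vector_derivative
      ((1/2) * (complex_of_real a + \<i> * complex_of_real b)) *s mate (\<phi> s)) (at s within I)"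
proof -
  define k where "k = (1/2) * (complex_of_real a + \<i> * complex_of_real b)"
  have XY: "sigma_form (\<phi> t) (\<phi> t) = complexify (X t) + \<i> *s complexify (Y t)"
    and Z: "complexify (Z t) = - sigma_form (mate (\<phi> t)) (\<phi> t)" if "t \<in> I" for t
    using rep that by (auto simp: represents_triad_def)
  obtain D where D: "(\<phi> has_vector_derivative D) (at s within I)"
    using diff vector_derivative_works by blast
  have "((\<lambda>t. complexify (X t) + \<i> *s complexify (Y t)) has_vector_derivative
      complexify (- (a *\<^sub>R Z s)) + \<i> *s complexify (- (b *\<^sub>R Z s))) (at s within I)"
    by (intro has_vector_derivative_add
        bounded_linear.has_vector_derivative[OF bounded_linear_smult]
        bounded_linear.has_vector_derivative[OF bounded_linear_complexify] dX dY)
  then have "((\<lambda>t. sigma_form (\<phi> t) (\<phi> t)) has_vector_derivative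
      complexify (- (a *\<^sub>R Z s)) + \<i> *s complexify (- (b *\<^sub>R Z s))) (at s within I)"
    by (auto intro: has_vector_derivative_transform[OF s, rotated] simp: XY)
  then have "sigma_form (\<phi> s) D + sigma_form D (\<phi> s)
      = complexify (- (a *\<^sub>R Z s)) + \<i> *s complexify (- (b *\<^sub>R Z s))"
    using has_vector_derivative_sigma_form[OF D D] nontriv
    by (blast intro: vector_derivative_unique_within)
  also have "\<dots> = - ((2 * k) *s complexify (Z s))"
    by (simp add: vec_eq_iff complexify_def k_def algebra_simps)
  \<comment> \<open>Replacing Z by its spinor expression puts both sides in the form of a pairing
    with \<open>\<phi> s\<close>, ready for cancellation.\<close>
  finally have "2 *s sigma_form (\<phi> s) D = 2 *s sigma_form (\<phi> s) (k *s mate (\<phi> s))"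
    by (simp add: Z[OF s] sigma_form_smult_right sigma_form_commute[of _ "\<phi> s"] vec_eq_iff)
  then have "sigma_form (\<phi> s) D = sigma_form (\<phi> s) (k *s mate (\<phi> s))"
    by (simp add: vec_eq_iff)
  then have "D = k *s mate (\<phi> s)"
    using nz by (rule sigma_form_right_cancel[rotated])
  then show ?thesis
    using D by (simp add: k_def)
qed

theorem theorem3:
  fixes I :: "real set"
    and \<alpha> T N B \<zeta>1 \<zeta>2 :: "real \<Rightarrow> real^3"
    and \<epsilon>1 \<epsilon>2 :: "real \<Rightarrow> real"
    and \<phi> :: "real \<Rightarrow> complex^2"
  assumes "is_interval I" and "interior I \<noteq> {}"
    and "unit_speed_curve I \<alpha>"
    and "frenet_frame I \<alpha> T N B"
    and "\<zeta>1 differentiable_on I" and "\<zeta>2 differentiable_on I" and "B differentiable_on I"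
    and "oriented_orthonormal_frame I \<zeta>1 \<zeta>2 B"
    and "\<phi> differentiable_on I"
    and "\<And>s. s \<in> I \<Longrightarrow> (\<Sum>i\<in>UNIV. cnj (\<phi> s $ i) * \<phi> s $ i) = 1"
    and "represents_triad \<phi> I \<zeta>1 \<zeta>2 B"
  shows "type2_bishop_equations I \<zeta>1 \<zeta>2 B \<epsilon>1 \<epsilon>2 \<longleftrightarrow>
    (\<forall>s\<in>I. (\<phi> has_vector_derivative
        ((1/2) * (complex_of_real (\<epsilon>1 s) + \<i> * complex_of_real (\<epsilon>2 s))) *s mate (\<phi> s))
      (at s within I))"
proof -
  \<comment> \<open>A zero spinor would make the normalisation read 0 = 1.\<close>
  have nz: "\<phi> s \<noteq> 0" if "s \<in> I" for s
    using assms(10)[OF that] by auto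
  show ?thesis
    unfolding type2_bishop_equations_def
    using spinor_equation_imp_bishop[OF assms(11)] bishop_imp_spinor_equation[OF assms(11)]
      at_within_interval_neq_bot[OF assms(1,2)] nz assms(9)
    unfolding differentiable_on_def by blast
qed

end
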